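(* Let $1\le p<\infty$ and let $\omega=\{\omega(k)\}_{k\in\mathbb{N}}\in\mathcal{A}_p(\mathbb{N})$. Define $\widetilde\omega(k):=\omega(|k|)$ for $k\in\mathbb{Z}$. Then $\widetilde\omega\in\mathcal{A}_p(\mathbb{Z})$, and $$\|\widetilde\omega\|_{\mathcal{A}_p(\mathbb{Z})}\le\begin{cases}4\|\omega\|_{\mathcal{A}_1(\mathbb{N})}, & p=1,\\ 4C_{2,p}\|\omega\|_{\mathcal{A}_p(\mathbb{N})}, & p>1,\end{cases}$$ where, for $p>1$, $C_{2,p}$ is a constant depending only on $p$ such that $(a+b)^{p-1}\le C_{2,p}(a^{p-1}+b^{p-1})$ for all $a,b\ge 0$.
   Context: Let $\mathbb{N}=\{0,1,2,\dots\}$ and let $X$ be $\mathbb{Z}$ or $\mathbb{N}$. A discrete weight on $X$ is a family $\omega=\{\omega(k)\}_{k\in X}$ of positive real numbers. An interval $J\subset X$ is a nonempty finite set of consecutive integers contained in $X$, and $|J|$ is its cardinality. $\omega\in\mathcal{A}_1(X)$ means $$\|\omega\|_{\mathcal{A}_1(X)}:=\sup_{J\subset X}\frac1{|J|}\Big(\frac{1}{\inf_{k\in J}\omega(k)}\sum_{k\in J}\omega(k)\Big)<\infty.$$ For $1<p<\infty$, $\omega\in\mathcal{A}_p(X)$ means $$\|\omega\|_{\mathcal{A}_p(X)}:=\sup_{J\subset X}\Big(\frac1{|J|}\sum_{k\in J}\omega(k)\Big)\Big(\frac1{|J|}\sum_{k\in J}\omega(k)^{-\frac1{p-1}}\Big)^{p-1}<\infty.$$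 The suprema are over all intervals $J\subset X$. *)

theory Defs
  imports Complex_Main "HOL-Library.Extended_Real"
begin

text \<open>
  The index set \<open>X\<close> is rendered as a type: the definitions below are meant for
  \<open>'a = nat\<close> (\<open>X = \<nat>\<close>, with \<open>0\<close> included) and \<open>'a = int\<close> (\<open>X = \<int>\<close>). In both cases the sets
  \<open>{a..b}\<close> with \<open>a \<le> b\<close> are exactly the nonempty finite sets of consecutive elements.
\<close>

definition discrete_weight :: "('a \<Rightarrow> real) \<Rightarrow> bool" where
  "discrete_weight w \<longleftrightarrow> (\<forall>k. w k > 0)"

definition intervals :: "'a::linorder set set" where
  "intervals = {{a..b} | a b. a \<le> b}"

text \<open>
  The suprema are taken in the extended reals, so that an infinite supremum is really
  \<open>\<infinity>\<close>. The value for \<open>p < 1\<close> is irrelevant.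
\<close>

definition Ap_norm :: "real \<Rightarrow> ('a::linorder \<Rightarrow> real) \<Rightarrow> ereal" where
  "Ap_norm p w =
    (if p = 1
     then SUP J\<in>intervals. ereal (1 / real (card J) * (1 / (INF k\<in>J. w k) * (\<Sum>k\<in>J. w k)))
     else SUP J\<in>intervals. ereal
            ((1 / real (card J) * (\<Sum>k\<in>J. w k)) *
             (1 / real (card J) * (\<Sum>k\<in>J. w k powr (- 1 / (p - 1)))) powr (p - 1)))"

definition Ap :: "real \<Rightarrow> ('a::linorder \<Rightarrow> real) set" where
  "Ap p = {w. discrete_weight w \<and> Ap_norm p w < \<infinity>}"

definition even_extension :: "(nat \<Rightarrow> real) \<Rightarrow> int \<Rightarrow> real" where
  "even_extension w k = w (nat \<bar>k\<bar>)"

text \<open>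
  \<open>C\<close> is an admissible choice of the constant \<open>C\<^bsub>2,p\<^esub>\<close>. The condition involves \<open>p\<close> only,
  and by the lemma below it can be met for every \<open>p > 1\<close>.
\<close>

definition is_C2 :: "real \<Rightarrow> real \<Rightarrow> bool" where
  "is_C2 p C \<longleftrightarrow>
    (\<forall>a b. a \<ge> 0 \<longrightarrow> b \<ge> 0 \<longrightarrow> (a + b) powr (p - 1) \<le> C * (a powr (p - 1) + b powr (p - 1)))"

lemma ex_is_C2:
  assumes "p > 1"
  shows "\<exists>C. is_C2 p C"
proof -
  have "(a + b) powr (p - 1) \<le> 2 powr (p - 1) * (a powr (p - 1) + b powr (p - 1))"
    if "a \<ge> 0" "b \<ge> 0" for a b :: real
  proof -
    have "(a + b) powr (p - 1) \<le> (2 * max a b) powr (p - 1)"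
      using assms that by (intro powr_mono2) auto
    also have "\<dots> = 2 powr (p - 1) * max a b powr (p - 1)"
      using that by (intro powr_mult)
    also have "\<dots> \<le> 2 powr (p - 1) * (a powr (p - 1) + b powr (p - 1))"
      by (intro mult_left_mono) (auto simp: max_def)
    finally show ?thesis .
  qed
  then show ?thesis
    unfolding is_C2_def by blast
qed

end

theory Submission
  imports Defs
begin

text \<open>
  The map \<open>k \<mapsto> \<bar>k\<bar>\<close> is at most two-to-one and sends an interval \<open>J\<close> of \<open>\<int>\<close> onto an interval
  \<open>K\<close> of \<open>\<nat>\<close> with \<open>\<bar>K\<bar> \<le> \<bar>J\<bar>\<close>. Hence the average over \<open>J\<close> of a nonnegative even function is at
  most twice its average over \<open>K\<close>, which gives the bound \<open>2\<^sup>p\<close> for the ratio of the two norms.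
  Evaluating the defining inequality of \<open>C\<^bsub>2,p\<^esub>\<close> at \<open>a = b = 1\<close> shows \<open>2\<^sup>p \<le> 4 C\<^bsub>2,p\<^esub>\<close>.
\<close>

lemma image_nat_abs_interval:
  fixes a b :: int
  assumes "a \<le> b"
  shows "(\<lambda>k. nat \<bar>k\<bar>) ` {a..b} \<in> intervals"
proof -
  have "\<exists>c d. (\<lambda>k. nat \<bar>k\<bar>) ` {a..b} = {c..d} \<and> c \<le> d"
  proof (cases "0 \<le> a \<or> b \<le> 0")
    case True
    then show ?thesis
    proof
      assume "0 \<le> a"
      then have "(\<lambda>k. nat \<bar>k\<bar>) ` {a..b} = {nat a..nat b}"
        using assms by (auto intro!: image_eqI[where x = "int _"]; linarith)
      then show ?thesis
        using assms by (intro exI[of _ "nat a"] exI[of _ "nat b"]) auto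
    next
      assume "b \<le> 0"
      then have "(\<lambda>k. nat \<bar>k\<bar>) ` {a..b} = {nat (- b)..nat (- a)}"
        using assms by (auto intro!: image_eqI[where x = "- int _"]; linarith)
      then show ?thesis
        using assms by (intro exI[of _ "nat (- b)"] exI[of _ "nat (- a)"]) auto
    qed
  next
    case False
    \<comment> \<open>Here a < 0 < b, so the image starts at 0 and reaches the longer of the two
      arms. A value x beyond b can only come from the negative arm: then the maximum is -a, and -x
      is a preimage.\<close>
    have "x \<in> (\<lambda>k. nat \<bar>k\<bar>) ` {a..b}" if "x \<le> nat (max (- a) b)" for x
    proof (cases "int x \<le> b")
      case True
      then show ?thesis
        using False by (intro image_eqI[of _ _ "int x"]) auto
    next
      case False
      then show ?thesis
        using that \<open>\<not> (0 \<le> a \<or> b \<le> 0)\<close> by (intro image_eqI[of _ _ "- int x"]) auto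
    qed
    then have "(\<lambda>k. nat \<bar>k\<bar>) ` {a..b} = {0..nat (max (- a) b)}"
      by auto
    then show ?thesis
      by blast
  qed
  then show ?thesis
    unfolding intervals_def by blast
qed

text \<open>Group the sum by the value n of \<open>nat \<bar>k\<bar>\<close>. Each fibre lies in {n,
  -n}, so it contributes at most two copies of the nonnegative number \<open>f n\<close>.\<close>

lemma sum_nat_abs_le:
  fixes f :: "nat \<Rightarrow> real"
  assumes "finite J" and "\<And>k. 0 \<le> f k"
  shows "(\<Sum>k\<in>J. f (nat \<bar>k\<bar>)) \<le> 2 * (\<Sum>k\<in>(\<lambda>k. nat \<bar>k\<bar>) ` J. f k)"
proof -
  have "(\<Sum>k | k \<in> J \<and> nat \<bar>k\<bar> = n. f (nat \<bar>k\<bar>)) \<le> 2 * f n" for n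
  proof -
    have "card {k \<in> J. nat \<bar>k\<bar> = n} \<le> card {int n, - int n}"
      by (intro card_mono) auto
    also have "\<dots> \<le> 2"
      by (simp add: card_insert_if)
    finally show ?thesis
      using assms(2)[of n] by (simp add: mult_right_mono)
  qed
  then show ?thesis
    by (subst sum.image_gen[OF \<open>finite J\<close>, of _ "\<lambda>k. nat \<bar>k\<bar>"])
      (simp add: sum_distrib_left sum_mono)
qed

text \<open>Passing from J to K can only shrink the cardinality, hence enlarge the prefactor; the
  sole loss is the 2 from the fibres.\<close>

lemma average_nat_abs_le:
  fixes f :: "nat \<Rightarrow> real"
  assumes "finite J" and "J \<noteq> {}" and "\<And>k. 0 \<le> f k"
  defines "K \<equiv> (\<lambda>k. nat \<bar>k\<bar>) ` J"
  shows "1 / real (card J) * (\<Sum>k\<in>J. f (nat \<bar>k\<bar>)) \<le> 2 * (1 / real (card K) * (\<Sum>k\<in>K. f k))"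
proof -
  have "0 < card K" "card K \<le> card J"
    using assms by (auto simp: K_def card_image_le card_gt_0_iff)
  then have "1 / real (card J) * (\<Sum>k\<in>J. f (nat \<bar>k\<bar>)) \<le> 1 / real (card K) * (2 * (\<Sum>k\<in>K. f k))"
    using sum_nat_abs_le[of J f] assms
    by (intro mult_mono) (auto simp: frac_le sum_nonneg)
  then show ?thesis
    by simp
qed

text \<open>Lets an extended-real product with the norm be compared when its constant grows. A
  single one-point interval bounds the supremum from below.\<close>

lemma Ap_norm_nonneg:
  fixes w :: "'a::linorder \<Rightarrow> real"
  assumes "discrete_weight w"
  shows "0 \<le> Ap_norm p w"
proof -
  obtain a :: 'a where True by simp
  have "{a..a} \<in> intervals"
    unfolding intervals_def by blast
  moreover have "0 < w a"
    using assms by (simp add: discrete_weight_def)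
  ultimately show ?thesis
    unfolding Ap_norm_def by (auto intro!: SUP_upper2[of "{a..a}"])
qed

text \<open>For p > 1 each of the two averages loses a factor 2, and the second is raised to the
  power p - 1, giving 2 * 2^(p-1) = 2^p. For p = 1 only one average occurs.\<close>

lemma Ap_norm_even_extension_le:
  assumes "1 \<le> p" and w: "discrete_weight w"
  shows "Ap_norm p (even_extension w) \<le> ereal (2 powr p) * Ap_norm p w"
proof (cases "p = 1")
  case True
  have "ereal (1 / real (card J) * (1 / (INF k\<in>J. even_extension w k) * (\<Sum>k\<in>J. even_extension w k)))
      \<le> 2 * Ap_norm 1 w" if "J \<in> intervals" for J
  proof -
    obtain a b where J: "J = {a..b}" "a \<le> b"
      using \<open>J \<in> intervals\<close> by (auto simp: intervals_def)
    define K where "K = (\<lambda>k. nat \<bar>k\<bar>) ` J"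
    have K: "K \<in> intervals" "finite K" "K \<noteq> {}"
      using J image_nat_abs_interval[of a b] by (auto simp: K_def)
    define m where "m = (INF k\<in>K. w k)"
    \<comment> \<open>Nonnegativity is enough for dividing by m: if m were 0, both sides below would
      be 0, since 1 / 0 = 0.\<close>
    have "0 \<le> m"
      unfolding m_def using K(3) w by (intro cINF_greatest) (auto simp: discrete_weight_def less_imp_le)
    \<comment> \<open>The extension takes on J exactly the values of \<open>w\<close> on K, so the
      infimum costs nothing.\<close>
    moreover have "(INF k\<in>J. even_extension w k) = m"
      by (simp add: m_def K_def even_extension_def image_image)
    moreover have "1 / real (card J) * (\<Sum>k\<in>J. even_extension w k)
        \<le> 2 * (1 / real (card K) * (\<Sum>k\<in>K. w k))"
      unfolding K_def even_extension_def using J w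
      by (intro average_nat_abs_le) (auto simp: discrete_weight_def less_imp_le)
    ultimately have "1 / real (card J) * (1 / (INF k\<in>J. even_extension w k) * (\<Sum>k\<in>J. even_extension w k))
        \<le> 2 * (1 / real (card K) * (1 / m * (\<Sum>k\<in>K. w k)))"
      using divide_right_mono[of _ _ m] by (fastforce simp: field_simps)
    then have "ereal (1 / real (card J) * (1 / (INF k\<in>J. even_extension w k) * (\<Sum>k\<in>J. even_extension w k)))
        \<le> 2 * ereal (1 / real (card K) * (1 / m * (\<Sum>k\<in>K. w k)))"
      by simp
    also have "\<dots> \<le> 2 * Ap_norm 1 w"
      unfolding Ap_norm_def m_def using K
      by (simp only: if_True simp_thms) (intro ereal_mult_left_mono SUP_upper; simp)
    finally show ?thesis .
  qed
  then show ?thesis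
    unfolding True by (subst Ap_norm_def) (auto intro!: SUP_least)
next
  case False
  then have "p > 1"
    using assms by simp
  let ?A = "\<lambda>J v. 1 / real (card J) * (\<Sum>k\<in>J. v k)"
  have "ereal (?A J (even_extension w) * ?A J (\<lambda>k. even_extension w k powr (- 1 / (p - 1))) powr (p - 1))
      \<le> ereal (2 powr p) * Ap_norm p w" if "J \<in> intervals" for J
  proof -
    obtain a b where J: "J = {a..b}" "a \<le> b"
      using \<open>J \<in> intervals\<close> by (auto simp: intervals_def)
    define K where "K = (\<lambda>k. nat \<bar>k\<bar>) ` J"
    have K: "K \<in> intervals"
      using J image_nat_abs_interval[of a b] by (auto simp: K_def)
    let ?\<sigma> = "\<lambda>k. w k powr (- 1 / (p - 1))"
    have A: "?A J (even_extension w) \<le> 2 * ?A K w"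
      unfolding K_def even_extension_def using J w
      by (intro average_nat_abs_le) (auto simp: discrete_weight_def less_imp_le)
    \<comment> \<open>The dual weight of the extension is the extension of the dual weight
      \<open>?\<sigma>\<close>, so the same averaging bound applies to it.\<close>
    have "?A J (\<lambda>k. even_extension w k powr (- 1 / (p - 1))) \<le> 2 * ?A K ?\<sigma>"
      unfolding K_def even_extension_def using J
      by (intro average_nat_abs_le[of J ?\<sigma>]) auto
    then have B: "?A J (\<lambda>k. even_extension w k powr (- 1 / (p - 1))) powr (p - 1) \<le> (2 * ?A K ?\<sigma>) powr (p - 1)"
      using \<open>p > 1\<close> by (intro powr_mono2) (auto simp: sum_nonneg)
    have "?A J (even_extension w) * ?A J (\<lambda>k. even_extension w k powr (- 1 / (p - 1))) powr (p - 1)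
        \<le> (2 * ?A K w) * (2 * ?A K ?\<sigma>) powr (p - 1)"
      using w by (intro mult_mono[OF A B]) (auto simp: sum_nonneg discrete_weight_def less_imp_le)
    also have "\<dots> = (2 * ?A K w) * (2 powr (p - 1) * ?A K ?\<sigma> powr (p - 1))"
      by (subst powr_mult) (auto simp: sum_nonneg)
    also have "\<dots> = 2 powr p * (?A K w * ?A K ?\<sigma> powr (p - 1))"
      by (simp add: powr_diff)
    finally have "ereal (?A J (even_extension w) * ?A J (\<lambda>k. even_extension w k powr (- 1 / (p - 1))) powr (p - 1))
        \<le> ereal (2 powr p) * ereal (?A K w * ?A K ?\<sigma> powr (p - 1))"
      by simp
    also have "\<dots> \<le> ereal (2 powr p) * Ap_norm p w"
      unfolding Ap_norm_def using K False
      by (simp only: if_False) (intro ereal_mult_left_mono SUP_upper; simp)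
    finally show ?thesis .
  qed
  then show ?thesis
    using False by (subst Ap_norm_def) (auto intro!: SUP_least)
qed

lemma is_C2_lower_bound:
  assumes "is_C2 p C"
  shows "2 powr p \<le> 4 * C"
proof -
  have "(1 + 1) powr (p - 1) \<le> C * (1 powr (p - 1) + 1 powr (p - 1))"
    using assms unfolding is_C2_def by (metis zero_le_one)
  then show ?thesis
    by (simp add: powr_diff)
qed

theorem proposition2p12:
  fixes p :: real and \<omega> :: "nat \<Rightarrow> real"
  assumes "1 \<le> p" and "\<omega> \<in> Ap p"
  shows "even_extension \<omega> \<in> Ap p \<and>
    (p = 1 \<longrightarrow> Ap_norm 1 (even_extension \<omega>) \<le> 4 * Ap_norm 1 \<omega>) \<and>
    (p > 1 \<longrightarrow> (\<forall>C. is_C2 p C \<longrightarrow>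
       Ap_norm p (even_extension \<omega>) \<le> ereal (4 * C) * Ap_norm p \<omega>))"
proof -
  have w: "discrete_weight \<omega>" and fin: "Ap_norm p \<omega> < \<infinity>"
    using assms by (auto simp: Ap_def)
  \<comment> \<open>The constant is left free to serve three times: 2^p for finiteness, 4 for p = 1,
    and 4C for p > 1.\<close>
  have bound: "Ap_norm p (even_extension \<omega>) \<le> ereal c * Ap_norm p \<omega>" if "2 powr p \<le> c" for c
    using Ap_norm_even_extension_le[OF assms(1) w]
      ereal_mult_right_mono[OF _ Ap_norm_nonneg[OF w, of p], of "ereal (2 powr p)" "ereal c"] that
    by (auto intro: order_trans)
  have "ereal (2 powr p) * Ap_norm p \<omega> < \<infinity>"
    using fin Ap_norm_nonneg[OF w, of p] by (cases "Ap_norm p \<omega>") auto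
  then have "Ap_norm p (even_extension \<omega>) < \<infinity>"
    using bound[of "2 powr p"] by auto
  moreover have "discrete_weight (even_extension \<omega>)"
    using w by (simp add: discrete_weight_def even_extension_def)
  ultimately show ?thesis
    using bound[of 4] bound is_C2_lower_bound by (auto simp: Ap_def)
qed

end
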